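(* Let $\mathbb{T}$ be a time scale, let $A:\mathbb{T}\to\mathbb{R}^{n\times n}$ be regressive, and let $L$ be a Lyapunov transformation, with change of variables $z(t)=L^{-1}(t)x(t)$. Then the system $$x^\Delta(t)=A(t)x(t),\quad x(t_0)=x_0$$ is uniformly asymptotically stable if and only if the system $$z^\Delta(t)=\left[(L^\sigma(t))^{-1}A(t)L(t)-(L^\sigma(t))^{-1}L^\Delta(t)\right]z(t),\quad z(t_0)=z_0$$ is uniformly asymptotically stable.
   Context: A time scale $\mathbb{T}$ is a nonempty closed subset of $\mathbb{R}$; $\sigma(t)=\inf\{s\in\mathbb{T}:s>t\}$, $\mu(t)=\sigma(t)-t$, $L^\sigma(t)=L(\sigma(t))$, and $f^\Delta$ is the delta (Hilger) derivative. $f$ is rd-continuous if continuous at right-dense points with finite left-sided limits at left-dense points; $C^1_{\mathrm{rd}}$ is the set of delta differentiable functions with rd-continuous derivative. $A$ is regressive if it is rd-continuous and $I+\mu(t)A(t)$ is invertible for all $t$. A Lyapunov transformation is an invertible matrix $L(t)\in C^1_{\mathrm{rd}}(\mathbb{T},\mathbb{R}^{n\times n})$ such that, for some positive $\eta,\rho\in\mathbb{R}$, $\|L(t)\|\le\rho$ and $\det L(t)\ge\eta$ for all $t\in\mathbb{T}$. A linear system is uniformly stable if there is a finite $\gamma>0$ such that for any $t_0\in\mathbb{T}$ and $x(t_0)$ the corresponding solution satisfies $\|x(t)\|\le\gamma\|x(t_0)\|$ for $t\ge t_0$. It is uniformly asymptotically stable if it is uniformly stable and, given any $\delta>0$, there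 exists $T>0$ such that for any $t_0\in\mathbb{T}$ and any $x(t_0)$ the corresponding solution satisfies $\|x(t)\|\le\delta\|x(t_0)\|$ for all $t\in\mathbb{T}$ with $t\ge t_0+T$. *)

theory Defs
  imports "HOL-Analysis.Analysis"
begin

definition time_scale :: "real set \<Rightarrow> bool" where
  "time_scale T \<longleftrightarrow> closed T \<and> T \<noteq> {}"

text \<open>The usual conventions \<open>inf {} = sup T\<close> and \<open>sup {} = inf T\<close> are in force for the jump
  operators, so a maximum (minimum) of \<open>T\<close> is fixed by the forward (backward) jump.\<close>

definition forward_jump :: "real set \<Rightarrow> real \<Rightarrow> real" where
  "forward_jump T t = (if {s \<in> T. s > t} = {} then Sup T else Inf {s \<in> T. s > t})"

definition backward_jump :: "real set \<Rightarrow> real \<Rightarrow> real" where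
  "backward_jump T t = (if {s \<in> T. s < t} = {} then Inf T else Sup {s \<in> T. s < t})"

definition graininess :: "real set \<Rightarrow> real \<Rightarrow> real" where
  "graininess T t = forward_jump T t - t"

text \<open>\<open>T\<close> without its left-scattered maximum, if it has one. There the delta
  derivative is not determined, so differential equations are imposed on this set only.\<close>

definition kappa :: "real set \<Rightarrow> real set" where
  "kappa T = (if bdd_above T then T - {backward_jump T (Sup T)<..Sup T} else T)"

definition right_dense :: "real set \<Rightarrow> real \<Rightarrow> bool" where
  "right_dense T t \<longleftrightarrow> (\<exists>s\<in>T. t < s) \<and> forward_jump T t = t"

definition left_dense :: "real set \<Rightarrow> real \<Rightarrow> bool" where
  "left_dense T t \<longleftrightarrow> (\<exists>s\<in>T. s < t) \<and> backward_jump T t = t"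

text \<open>Rd-continuity of \<open>f : X \<rightarrow> E\<close>, where \<open>X\<close> is \<open>T\<close> or \<open>kappa T\<close>; density of points always refers
  to \<open>T\<close>.\<close>

definition rd_continuous_on :: "real set \<Rightarrow> real set \<Rightarrow> (real \<Rightarrow> 'a::real_normed_vector) \<Rightarrow> bool" where
  "rd_continuous_on T X f \<longleftrightarrow>
    (\<forall>t\<in>X. (right_dense T t \<longrightarrow> continuous (at t within X) f) \<and>
           (left_dense T t \<longrightarrow> (\<exists>l. (f \<longlongrightarrow> l) (at t within (X \<inter> {..<t})))))"

definition has_delta_derivative ::
  "real set \<Rightarrow> (real \<Rightarrow> 'a::real_normed_vector) \<Rightarrow> 'a \<Rightarrow> real \<Rightarrow> bool" where
  "has_delta_derivative T f D t \<longleftrightarrow>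
    (\<forall>e>0. \<exists>d>0. \<forall>s\<in>T. \<bar>s - t\<bar> < d \<longrightarrow>
      norm (f (forward_jump T t) - f s - (forward_jump T t - s) *\<^sub>R D)
        \<le> e * \<bar>forward_jump T t - s\<bar>)"

definition delta_deriv :: "real set \<Rightarrow> (real \<Rightarrow> 'a::real_normed_vector) \<Rightarrow> real \<Rightarrow> 'a" where
  "delta_deriv T f t = (SOME D. has_delta_derivative T f D t)"

definition C1_rd :: "real set \<Rightarrow> (real \<Rightarrow> 'a::real_normed_vector) \<Rightarrow> bool" where
  "C1_rd T f \<longleftrightarrow>
    (\<forall>t\<in>kappa T. \<exists>D. has_delta_derivative T f D t) \<and>
    rd_continuous_on T (kappa T) (delta_deriv T f)"

definition regressive :: "real set \<Rightarrow> (real \<Rightarrow> real^'n^'n) \<Rightarrow> bool" where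
  "regressive T A \<longleftrightarrow>
    rd_continuous_on T T A \<and> (\<forall>t\<in>T. invertible (mat 1 + graininess T t *\<^sub>R A t))"

text \<open>The matrix norm is the operator norm induced by the Euclidean norm; \<open>norm\<close> on
  \<open>real^'n^'n\<close> would be the Frobenius norm.\<close>

definition lyapunov_transformation :: "real set \<Rightarrow> (real \<Rightarrow> real^'n^'n) \<Rightarrow> bool" where
  "lyapunov_transformation T L \<longleftrightarrow>
    C1_rd T L \<and> (\<forall>t\<in>T. invertible (L t)) \<and>
    (\<exists>\<eta>>0. \<exists>\<rho>>0. \<forall>t\<in>T. onorm ((*v) (L t)) \<le> \<rho> \<and> det (L t) \<ge> \<eta>)"

text \<open>Solutions live on the whole time scale (for regressive coefficients they extend to both
  sides of \<open>t\<^sub>0\<close>); values outside \<open>T\<close> are irrelevant.\<close>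

definition ivp_solution ::
  "real set \<Rightarrow> (real \<Rightarrow> real^'n^'n) \<Rightarrow> real \<Rightarrow> real^'n \<Rightarrow> (real \<Rightarrow> real^'n) \<Rightarrow> bool" where
  "ivp_solution T A t\<^sub>0 x\<^sub>0 x \<longleftrightarrow>
    (\<forall>t\<in>kappa T. has_delta_derivative T x (A t *v x t) t) \<and> x t\<^sub>0 = x\<^sub>0"

definition uniformly_stable :: "real set \<Rightarrow> (real \<Rightarrow> real^'n^'n) \<Rightarrow> bool" where
  "uniformly_stable T A \<longleftrightarrow>
    (\<exists>\<gamma>>0. \<forall>t\<^sub>0\<in>T. \<forall>x\<^sub>0 x. ivp_solution T A t\<^sub>0 x\<^sub>0 x \<longrightarrow>
      (\<forall>t\<in>T. t \<ge> t\<^sub>0 \<longrightarrow> norm (x t) \<le> \<gamma> * norm (x t\<^sub>0)))"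

definition uniformly_asymptotically_stable :: "real set \<Rightarrow> (real \<Rightarrow> real^'n^'n) \<Rightarrow> bool" where
  "uniformly_asymptotically_stable T A \<longleftrightarrow>
    uniformly_stable T A \<and>
    (\<forall>\<delta>>0. \<exists>\<tau>>0. \<forall>t\<^sub>0\<in>T. \<forall>x\<^sub>0 x. ivp_solution T A t\<^sub>0 x\<^sub>0 x \<longrightarrow>
      (\<forall>t\<in>T. t \<ge> t\<^sub>0 + \<tau> \<longrightarrow> norm (x t) \<le> \<delta> * norm (x t\<^sub>0)))"

end

theory Submission
  imports Defs
begin

text \<open>If \<open>L\<close> has delta derivative \<open>D\<close> at \<open>t\<close> and \<open>z\<close> is merely continuous there, then
  \<open>(L - L\<^sup>\<sigma>(t)) z\<close>, which vanishes at \<open>\<sigma>(t)\<close>, still has delta derivative \<open>D z(t)\<close>.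
  Hence \<open>x = L z\<close> has a delta derivative at \<open>t\<close> exactly when \<open>L\<^sup>\<sigma>(t) z\<close>, equivalently \<open>z\<close>,
  has one, and the solutions of both systems correspond to each other; no derivative of \<open>L\<^sup>-\<^sup>1\<close>
  is needed. By compactness of the set of matrices with bounded norm and determinant at least
  \<open>\<eta>\<close>, a Lyapunov transformation is bounded below uniformly in \<open>t\<close>, so that \<open>\<parallel>x\<parallel>\<close> and \<open>\<parallel>z\<parallel>\<close> are
  comparable and stability estimates carry over.\<close>

section \<open>The forward jump and the set \<open>kappa T\<close>\<close>

lemma forward_jump_in_time_scale:
  assumes "time_scale T" "t \<in> T"
  shows "forward_jump T t \<in> T"
proof (cases "{s \<in> T. s > t} = {}")
  case True
  \<comment> \<open>Without a point of \<open>T\<close> beyond \<open>t\<close>, the jump takes its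
    default value \<open>Sup T\<close>. Since \<open>t\<close> bounds \<open>T\<close>, this
    supremum is attained by closedness.\<close>
  then have "bdd_above T"
    by (intro bdd_aboveI[of _ t]) force
  then show ?thesis
    using True assms by (simp add: forward_jump_def time_scale_def closed_contains_Sup)
next
  case False
  let ?S = "{s \<in> T. s > t}"
  have "bdd_below ?S"
    by (rule bdd_belowI[of _ t]) auto
  then have "Inf ?S \<in> closure ?S"
    by (rule closure_contains_Inf[OF False])
  also have "closure ?S \<subseteq> T"
    using assms by (intro closure_minimal) (auto simp: time_scale_def)
  finally show ?thesis
    using False by (auto simp: forward_jump_def)
qed

lemma kappa_subset:
  "kappa T \<subseteq> T"
  by (auto simp: kappa_def)

section \<open>Calculus of the delta derivative at a point\<close>

lemma has_delta_derivative_cong: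
  assumes "\<And>s. s \<in> T \<Longrightarrow> f s = g s" "forward_jump T t \<in> T"
  shows "has_delta_derivative T f D t \<longleftrightarrow> has_delta_derivative T g D t"
  using assms by (simp add: has_delta_derivative_def)

lemma has_delta_derivative_add:
  assumes "has_delta_derivative T f D t" "has_delta_derivative T g E t"
  shows "has_delta_derivative T (\<lambda>s. f s + g s) (D + E) t"
  unfolding has_delta_derivative_def
proof (intro allI impI)
  fix e :: real assume "e > 0"
  then have "e / 2 > 0" by simp
  let ?\<sigma> = "forward_jump T t"
  obtain d1 where d1: "d1 > 0" "\<And>s. s \<in> T \<Longrightarrow> \<bar>s - t\<bar> < d1 \<Longrightarrow>
      norm (f ?\<sigma> - f s - (?\<sigma> - s) *\<^sub>R D) \<le> e / 2 * \<bar>?\<sigma> - s\<bar>"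
    using assms(1) \<open>e / 2 > 0\<close> unfolding has_delta_derivative_def by meson
  obtain d2 where d2: "d2 > 0" "\<And>s. s \<in> T \<Longrightarrow> \<bar>s - t\<bar> < d2 \<Longrightarrow>
      norm (g ?\<sigma> - g s - (?\<sigma> - s) *\<^sub>R E) \<le> e / 2 * \<bar>?\<sigma> - s\<bar>"
    using assms(2) \<open>e / 2 > 0\<close> unfolding has_delta_derivative_def by meson
  have "norm (f ?\<sigma> + g ?\<sigma> - (f s + g s) - (?\<sigma> - s) *\<^sub>R (D + E)) \<le> e * \<bar>?\<sigma> - s\<bar>"
    if s: "s \<in> T" "\<bar>s - t\<bar> < min d1 d2" for s
  proof -
    have "f ?\<sigma> + g ?\<sigma> - (f s + g s) - (?\<sigma> - s) *\<^sub>R (D + E)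
      = (f ?\<sigma> - f s - (?\<sigma> - s) *\<^sub>R D) + (g ?\<sigma> - g s - (?\<sigma> - s) *\<^sub>R E)"
      by (simp add: algebra_simps)
    also have "norm \<dots> \<le> e / 2 * \<bar>?\<sigma> - s\<bar> + e / 2 * \<bar>?\<sigma> - s\<bar>"
      using s d1 d2 by (intro norm_triangle_mono) auto
    finally show ?thesis by simp
  qed
  then show "\<exists>d>0. \<forall>s\<in>T. \<bar>s - t\<bar> < d \<longrightarrow>
      norm (f ?\<sigma> + g ?\<sigma> - (f s + g s) - (?\<sigma> - s) *\<^sub>R (D + E)) \<le> e * \<bar>?\<sigma> - s\<bar>"
    using d1(1) d2(1) by (intro exI[of _ "min d1 d2"]) auto
qed

lemma has_delta_derivative_bounded_linear:
  assumes "bounded_linear h" "has_delta_derivative T f D t"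
  shows "has_delta_derivative T (\<lambda>s. h (f s)) (h D) t"
  unfolding has_delta_derivative_def
proof (intro allI impI)
  interpret h: bounded_linear h by fact
  obtain K where K: "K > 0" "\<And>x. norm (h x) \<le> norm x * K"
    using h.pos_bounded by blast
  fix e :: real assume "e > 0"
  then have "e / K > 0" using K(1) by simp
  let ?\<sigma> = "forward_jump T t"
  obtain d where d: "d > 0" "\<And>s. s \<in> T \<Longrightarrow> \<bar>s - t\<bar> < d \<Longrightarrow>
      norm (f ?\<sigma> - f s - (?\<sigma> - s) *\<^sub>R D) \<le> e / K * \<bar>?\<sigma> - s\<bar>"
    using assms(2) \<open>e / K > 0\<close> unfolding has_delta_derivative_def by meson
  have "norm (h (f ?\<sigma>) - h (f s) - (?\<sigma> - s) *\<^sub>R h D) \<le> e * \<bar>?\<sigma> - s\<bar>"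
    if s: "s \<in> T" "\<bar>s - t\<bar> < d" for s
  proof -
    have "norm (h (f ?\<sigma>) - h (f s) - (?\<sigma> - s) *\<^sub>R h D)
      = norm (h (f ?\<sigma> - f s - (?\<sigma> - s) *\<^sub>R D))"
      by (simp add: h.diff h.scaleR)
    also have "\<dots> \<le> norm (f ?\<sigma> - f s - (?\<sigma> - s) *\<^sub>R D) * K"
      by (rule K)
    also have "\<dots> \<le> (e / K * \<bar>?\<sigma> - s\<bar>) * K"
      using K(1) d s by (intro mult_right_mono) auto
    finally show ?thesis using K(1) by simp
  qed
  then show "\<exists>d>0. \<forall>s\<in>T. \<bar>s - t\<bar> < d \<longrightarrow>
      norm (h (f ?\<sigma>) - h (f s) - (?\<sigma> - s) *\<^sub>R h D) \<le> e * \<bar>?\<sigma> - s\<bar>"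
    using d(1) by blast
qed

text \<open>The estimate applies at \<open>s\<close> and also at \<open>t\<close> itself. In the
  difference of the two the value at the forward jump cancels, leaving two small remainders and the
  linear term \<open>(s - t) *\<^sub>R D\<close>.\<close>

lemma has_delta_derivative_continuous:
  assumes "has_delta_derivative T f D t" "t \<in> T"
  shows "continuous (at t within T) f"
  unfolding continuous_within_eps_delta
proof (intro allI impI)
  fix e :: real assume e: "e > 0"
  let ?\<sigma> = "forward_jump T t"
  \<comment> \<open>Once \<open>\<bar>s - t\<bar> < 1\<close>, \<open>M\<close> bounds
    \<open>\<bar>?\<sigma> - t\<bar> + \<bar>?\<sigma> - s\<bar>\<close>, so both remainders
    together cost at most \<open>e / 2\<close>. The last bound in \<open>r\<close> leaves the other
    half to the linear term; \<open>norm D + 1\<close> keeps its denominator positive.\<close>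
  define M where "M = 2 * \<bar>?\<sigma> - t\<bar> + 1"
  have M: "M > 0" by (simp add: M_def add_nonneg_pos)
  have "e / (2 * M) > 0" using e M by simp
  then obtain d where d: "d > 0" "\<And>s. s \<in> T \<Longrightarrow> \<bar>s - t\<bar> < d \<Longrightarrow>
      norm (f ?\<sigma> - f s - (?\<sigma> - s) *\<^sub>R D) \<le> e / (2 * M) * \<bar>?\<sigma> - s\<bar>"
    using assms(1) unfolding has_delta_derivative_def by meson
  define r where "r = min (min d 1) (e / (2 * (norm D + 1)))"
  have D1: "norm D + 1 > 0"
    by (smt (verit) norm_ge_zero)
  have r: "r > 0" using d(1) e D1 by (simp add: r_def)
  have "dist (f s) (f t) < e" if s: "s \<in> T" "dist s t < r" for s
  proof -
    have st: "\<bar>s - t\<bar> < d" "\<bar>s - t\<bar> < 1" "\<bar>s - t\<bar> < e / (2 * (norm D + 1))"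
      using s by (auto simp: r_def dist_real_def)
    let ?R = "\<lambda>s. f ?\<sigma> - f s - (?\<sigma> - s) *\<^sub>R D"
    have "f s - f t = ?R t - ?R s + (s - t) *\<^sub>R D"
      by (simp add: algebra_simps)
    also have "norm \<dots> \<le> (norm (?R t) + norm (?R s)) + norm ((s - t) *\<^sub>R D)"
      by (intro norm_triangle_mono norm_triangle_ineq4 order_refl)
    also have "\<dots> \<le> (e / (2 * M) * \<bar>?\<sigma> - t\<bar> + e / (2 * M) * \<bar>?\<sigma> - s\<bar>) + \<bar>s - t\<bar> * (norm D + 1)"
      using d st s assms(2) by (intro add_mono) (auto intro!: mult_left_mono)
    also have "\<dots> = e / (2 * M) * (\<bar>?\<sigma> - t\<bar> + \<bar>?\<sigma> - s\<bar>) + \<bar>s - t\<bar> * (norm D + 1)"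
      by (simp add: algebra_simps)
    also have "\<dots> < e / (2 * M) * M + e / (2 * (norm D + 1)) * (norm D + 1)"
    proof (rule add_le_less_mono)
      show "e / (2 * M) * (\<bar>?\<sigma> - t\<bar> + \<bar>?\<sigma> - s\<bar>) \<le> e / (2 * M) * M"
        using e M st by (intro mult_left_mono) (auto simp: M_def)
      show "\<bar>s - t\<bar> * (norm D + 1) < e / (2 * (norm D + 1)) * (norm D + 1)"
        using st D1 by (intro mult_strict_right_mono) auto
    qed
    also have "\<dots> = e"
      using M D1 by (simp add: field_simps)
    finally show ?thesis by (simp add: dist_norm)
  qed
  then show "\<exists>d>0. \<forall>s\<in>T. dist s t < d \<longrightarrow> dist (f s) (f t) < e"
    using r by blast
qed

text \<open>The first factor vanishes at the forward jump and is of order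
  \<open>forward_jump T t - s\<close> near \<open>t\<close>. An error in \<open>g\<close> is
  multiplied by that order, so continuity of \<open>g\<close> suffices; since \<open>s\<close> tends
  to \<open>t\<close> and not to the jump, the value \<open>g t\<close> appears.\<close>

lemma (in bounded_bilinear) has_delta_derivative_mult_continuous:
  assumes "has_delta_derivative T f D t" "continuous (at t within T) g"
  shows "has_delta_derivative T (\<lambda>s. prod (f s - f (forward_jump T t)) (g s)) (prod D (g t)) t"
  unfolding has_delta_derivative_def
proof (intro allI impI)
  fix e :: real assume e: "e > 0"
  let ?\<sigma> = "forward_jump T t"
  let ?h = "\<lambda>s. prod (f s - f ?\<sigma>) (g s)"
  obtain K where K: "K > 0" "\<And>a b. norm (prod a b) \<le> norm a * norm b * K"
    using pos_bounded by blast
  \<comment> \<open>Half of \<open>e\<close> each: \<open>e1\<close> pays for the remainder of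
    \<open>f\<close>, \<open>e2\<close> for replacing \<open>g s\<close> by \<open>g t\<close>.
    Capping \<open>e2\<close> at 1 yields \<open>norm (g s) \<le> norm (g t) + 1\<close>, the factor
    provided for in \<open>e1\<close>.\<close>
  define e1 where "e1 = e / (2 * K * (norm (g t) + 1))"
  define e2 where "e2 = min 1 (e / (2 * K * (norm D + 1)))"
  have pos: "norm (g t) + 1 > 0" "norm D + 1 > 0"
    by (smt (verit) norm_ge_zero)+
  have e12: "e1 > 0" "e2 > 0"
    using e K(1) pos by (auto simp: e1_def e2_def)
  obtain d1 where d1: "d1 > 0" "\<And>s. s \<in> T \<Longrightarrow> \<bar>s - t\<bar> < d1 \<Longrightarrow>
      norm (f ?\<sigma> - f s - (?\<sigma> - s) *\<^sub>R D) \<le> e1 * \<bar>?\<sigma> - s\<bar>"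
    using assms(1) e12 unfolding has_delta_derivative_def by meson
  obtain d2 where d2: "d2 > 0" "\<And>s. s \<in> T \<Longrightarrow> \<bar>s - t\<bar> < d2 \<Longrightarrow> norm (g s - g t) < e2"
    using assms(2) e12 unfolding continuous_within_eps_delta dist_norm real_norm_def by meson
  have "norm (?h ?\<sigma> - ?h s - (?\<sigma> - s) *\<^sub>R prod D (g t)) \<le> e * \<bar>?\<sigma> - s\<bar>"
    if s: "s \<in> T" "\<bar>s - t\<bar> < min d1 d2" for s
  proof -
    let ?R = "f ?\<sigma> - f s - (?\<sigma> - s) *\<^sub>R D"
    have g: "norm (g s - g t) \<le> e2"
      using d2(2)[of s] s by simp
    have gs: "norm (g s) \<le> norm (g t) + 1"
      using g norm_triangle_sub[of "g s" "g t"] by (simp add: e2_def)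
    have "?h ?\<sigma> - ?h s - (?\<sigma> - s) *\<^sub>R prod D (g t)
      = prod ?R (g s) + (?\<sigma> - s) *\<^sub>R prod D (g s - g t)"
      by (simp add: diff_left diff_right scaleR_left zero_left scaleR_diff_left scaleR_diff_right)
    also have "norm \<dots> \<le> norm ?R * norm (g s) * K + \<bar>?\<sigma> - s\<bar> * (norm D * norm (g s - g t) * K)"
      by (intro norm_triangle_mono) (auto intro!: K mult_left_mono)
    also have "\<dots> \<le> e1 * \<bar>?\<sigma> - s\<bar> * (norm (g t) + 1) * K + \<bar>?\<sigma> - s\<bar> * ((norm D + 1) * e2 * K)"
      using d1(2)[of s] s K(1) e12 g gs
      by (intro add_mono mult_mono mult_nonneg_nonneg) auto
    also have "\<dots> = (e1 * (norm (g t) + 1) * K + e2 * ((norm D + 1) * K)) * \<bar>?\<sigma> - s\<bar>"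
      by (simp add: algebra_simps)
    also have "\<dots> \<le> (e / 2 + e / (2 * K * (norm D + 1)) * ((norm D + 1) * K)) * \<bar>?\<sigma> - s\<bar>"
      using K(1) pos by (intro mult_right_mono add_mono) (auto simp: e1_def e2_def)
    also have "\<dots> = e * \<bar>?\<sigma> - s\<bar>"
      using K(1) pos by simp
    finally show ?thesis .
  qed
  then show "\<exists>d>0. \<forall>s\<in>T. \<bar>s - t\<bar> < d \<longrightarrow>
      norm (?h ?\<sigma> - ?h s - (?\<sigma> - s) *\<^sub>R prod D (g t)) \<le> e * \<bar>?\<sigma> - s\<bar>"
    using d1(1) d2(1) by (intro exI[of _ "min d1 d2"]) auto
qed

section \<open>Matrices: inverses, a uniform lower bound, and products
  \<open>L s *v z s\<close>\<close>

lemma matrix_inv_mult: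
  fixes A :: "'a::semiring_1^'n^'m"
  assumes "invertible A"
  shows matrix_inv_right: "A ** matrix_inv A = mat 1"
    and matrix_inv_left: "matrix_inv A ** A = mat 1"
  using someI_ex[OF assms[unfolded invertible_def]] by (simp_all add: matrix_inv_def)

lemma bounded_bilinear_matrix_vector_mult:
  "bounded_bilinear ((*v) :: real^'n^'m \<Rightarrow> real^'n \<Rightarrow> real^'m)"
proof -
  have "bilinear ((*v) :: real^'n^'m \<Rightarrow> real^'n \<Rightarrow> real^'m)"
    by (auto simp: bilinear_def linear_iff matrix_vector_mult_add_rdistrib scaleR_matrix_vector_assoc
        matrix_vector_right_distrib matrix_vector_mult_scaleR)
  then show ?thesis
    by (simp add: bilinear_conv_bounded_bilinear)
qed

text \<open>On pairs of a matrix from a compact set and a unit vector, \<open>norm (M *v v)\<close>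
  attains its minimum. This is positive because \<open>det M \<ge> \<eta> > 0\<close> excludes a
  kernel, and homogeneity in \<open>v\<close> covers all vectors. As \<open>c\<close> is chosen
  before \<open>M\<close>, it will serve all times at once.\<close>

lemma matrix_uniform_lower_bound:
  fixes \<eta> \<rho> :: real
  assumes "\<eta> > 0"
  shows "\<exists>c>0. \<forall>(M :: real^'n^'n) v. onorm ((*v) M) \<le> \<rho> \<and> det M \<ge> \<eta> \<longrightarrow>
      c * norm v \<le> norm (M *v v)"
proof -
  let ?C = "real CARD('n)"
  \<comment> \<open>Compactness is taken in the Frobenius norm. The operator norm bounds every
    entry, so each of the \<open>?C\<close> rows has norm at most \<open>?C * \<rho>\<close>; hence
    \<open>?K\<close> contains all matrices in question.\<close>
  let ?K = "{M :: real^'n^'n. norm M \<le> ?C * (?C * \<rho>) \<and> \<eta> \<le> det M}"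
  let ?P = "?K \<times> sphere (0 :: real^'n) 1"
  have cdet: "continuous_on UNIV (det :: real^'n^'n \<Rightarrow> real)"
    unfolding det_def by (intro continuous_intros)
  have "?K = cball 0 (?C * (?C * \<rho>)) \<inter> {M. \<eta> \<le> det M}"
    by (auto simp: dist_norm)
  moreover have "closed {M :: real^'n^'n. \<eta> \<le> det M}"
    using cdet by (intro closed_Collect_le) auto
  ultimately have "compact ?K"
    by (simp add: compact_Int_closed)
  then have "compact ?P"
    by (intro compact_Times compact_sphere)
  have bound: "norm M \<le> ?C * (?C * \<rho>)" if "onorm ((*v) M) \<le> \<rho>" for M :: "real^'n^'n"
  proof -
    have entry: "\<bar>M $ i $ j\<bar> \<le> \<rho>" for i j
      using matrix_component_le_onorm that by (rule order_trans)
    have row: "norm (M $ i) \<le> ?C * \<rho>" for i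
    proof -
      have "norm (M $ i) \<le> (\<Sum>j\<in>UNIV. \<bar>M $ i $ j\<bar>)"
        by (rule norm_le_l1_cart)
      also have "\<dots> \<le> ?C * \<rho>"
        using sum_bounded_above[of UNIV "\<lambda>j. \<bar>M $ i $ j\<bar>" \<rho>] entry by simp
      finally show ?thesis .
    qed
    have "norm M \<le> (\<Sum>i\<in>UNIV. norm (M $ i))"
      by (simp add: norm_vec_def L2_set_le_sum)
    also have "\<dots> \<le> ?C * (?C * \<rho>)"
      using sum_bounded_above[of UNIV "\<lambda>i. norm (M $ i)" "?C * \<rho>"] row by simp
    finally show ?thesis .
  qed
  show ?thesis
  proof (cases "?P = {}")
    \<comment> \<open>Unit vectors exist, so an empty product means that no matrix meets both
      bounds; the claim is vacuous and any positive constant will do.\<close>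
    case True
    have "(axis undefined 1 :: real^'n) \<in> sphere 0 1"
      by (simp add: norm_axis_1)
    then have "?K = {}"
      using True by blast
    then show ?thesis
      using bound by (intro exI[of _ 1]) auto
  next
    case False
    have "continuous_on ?P (\<lambda>p. norm (fst p *v snd p))"
      by (intro continuous_intros bounded_bilinear.continuous_on[OF bounded_bilinear_matrix_vector_mult])
    then obtain p where p: "p \<in> ?P" "\<And>q. q \<in> ?P \<Longrightarrow> norm (fst p *v snd p) \<le> norm (fst q *v snd q)"
      using continuous_attains_inf[OF \<open>compact ?P\<close> False] by blast
    define c where "c = norm (fst p *v snd p)"
    have "invertible (fst p)" "snd p \<noteq> 0"
      using p(1) assms by (auto simp: invertible_det_nz)
    then have "c > 0"
      by (metis c_def invertible_def matrix_left_invertible_ker zero_less_norm_iff)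
    moreover have "c * norm v \<le> norm (M *v v)"
      if "onorm ((*v) M) \<le> \<rho>" "det M \<ge> \<eta>" for M :: "real^'n^'n" and v
    proof (cases "v = 0")
      case False
      have "(M, v /\<^sub>R norm v) \<in> ?P"
        using that bound False by simp
      from p(2)[OF this] have "c \<le> norm (M *v v) / norm v"
        by (simp add: c_def matrix_vector_mult_scaleR divide_inverse_commute)
      then show ?thesis
        using False by (simp add: field_simps)
    qed simp
    ultimately show ?thesis
      by blast
  qed
qed

text \<open>Recovers continuity of \<open>z\<close> without inverting \<open>L\<close>: the vectors
  \<open>L s *v (z s - z t) = L s *v z s - L s *v z t\<close> tend to
  \<open>L t *v z t - L t *v z t = 0\<close>, and the lower bound forces \<open>z s - z t\<close> to
  follow.\<close>

lemma continuous_of_continuous_mult_matrix: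
  fixes L :: "real \<Rightarrow> real^'n^'m"
  assumes "c > 0" "\<And>s v. s \<in> T \<Longrightarrow> c * norm v \<le> norm (L s *v v)"
    and L: "continuous (at t within T) L" and x: "continuous (at t within T) (\<lambda>s. L s *v z s)"
  shows "continuous (at t within T) z"
proof -
  have "((\<lambda>s. L s *v z t) \<longlongrightarrow> L t *v z t) (at t within T)"
    using L unfolding continuous_within
    by (intro bounded_bilinear.tendsto[OF bounded_bilinear_matrix_vector_mult] tendsto_const)
  from tendsto_diff[OF x[unfolded continuous_within] this]
  have "((\<lambda>s. L s *v z s - L s *v z t) \<longlongrightarrow> 0) (at t within T)"
    by simp
  then have lim: "((\<lambda>s. norm (L s *v (z s - z t)) / c) \<longlongrightarrow> 0) (at t within T)"
    by (intro tendsto_divide_zero tendsto_norm_zero) (simp add: matrix_vector_mult_diff_distrib)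
  have "\<forall>\<^sub>F s in at t within T. norm (z s - z t) \<le> norm (L s *v (z s - z t)) / c"
    using assms(1,2) by (auto simp: eventually_at_filter field_simps)
  with lim have "((\<lambda>s. z s - z t) \<longlongrightarrow> 0) (at t within T)"
    by (rule Lim_null_comparison[rotated])
  then show ?thesis
    by (simp add: continuous_within LIM_zero_iff)
qed

text \<open>The product rule \<open>w = D z(t) + L(\<sigma>(t)) z'\<close>, solved for
  \<open>z'\<close>. It can be read in both directions because multiplication by the constant matrix
  \<open>L(\<sigma>(t))\<close> can be undone.\<close>

lemma has_delta_derivative_matrix_mult_iff:
  fixes L :: "real \<Rightarrow> real^'n^'n" and z :: "real \<Rightarrow> real^'n"
  assumes L: "has_delta_derivative T L D t" and z: "continuous (at t within T) z"
    and inv: "invertible (L (forward_jump T t))"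
  shows "has_delta_derivative T (\<lambda>s. L s *v z s) w t \<longleftrightarrow>
    has_delta_derivative T z (matrix_inv (L (forward_jump T t)) *v (w - D *v z t)) t"
    (is "?l \<longleftrightarrow> ?r")
proof -
  let ?M = "L (forward_jump T t)"
  note bl = bounded_bilinear.bounded_linear_right[OF bounded_bilinear_matrix_vector_mult]
  have inv_mult: "matrix_inv ?M *v (?M *v v) = v" "?M *v (matrix_inv ?M *v v) = v" for v
    using inv by (simp_all add: matrix_vector_mul_assoc matrix_inv_left matrix_inv_right)
  have diff: "has_delta_derivative T (\<lambda>s. (L s - ?M) *v z s) (D *v z t) t"
    by (rule bounded_bilinear.has_delta_derivative_mult_continuous
        [OF bounded_bilinear_matrix_vector_mult L z])
  show ?thesis
  proof
    assume ?l
    from has_delta_derivative_add[OF this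
        has_delta_derivative_bounded_linear[OF bounded_linear_minus[OF bounded_linear_ident] diff]]
    have "has_delta_derivative T (\<lambda>s. ?M *v z s) (w - D *v z t) t"
      by (simp add: matrix_vector_mult_diff_rdistrib)
    from has_delta_derivative_bounded_linear[OF bl[of "matrix_inv ?M"] this]
    show ?r
      by (simp add: inv_mult)
  next
    assume ?r
    from has_delta_derivative_add[OF has_delta_derivative_bounded_linear[OF bl[of ?M] this] diff]
    show ?l
      by (simp add: inv_mult matrix_vector_mult_diff_rdistrib)
  qed
qed

section \<open>Transfer of stability along solutions with comparable norms\<close>

lemma uniformly_asymptotically_stable_transfer:
  assumes "p > 0" "q > 0"
    and corr: "\<And>t\<^sub>0 z\<^sub>0 z. ivp_solution T B t\<^sub>0 z\<^sub>0 z \<Longrightarrow>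
      \<exists>x. ivp_solution T A t\<^sub>0 (x t\<^sub>0) x \<and>
        (\<forall>t\<in>T. norm (z t) \<le> p * norm (x t) \<and> norm (x t) \<le> q * norm (z t))"
    and stable: "uniformly_asymptotically_stable T A"
  shows "uniformly_asymptotically_stable T B"
proof -
  \<comment> \<open>Pass from \<open>z\<close> to \<open>x\<close> at time \<open>t\<close>, back to
    \<open>t\<^sub>0\<close> along \<open>x\<close>, and there from \<open>x\<close> to
    \<open>z\<close>. How far \<open>t\<close> lies beyond \<open>t\<^sub>0\<close> enters only
    through the premise on \<open>x\<close>, so one estimate serves both uniform stability and
    decay.\<close>
  have estimate: "norm (z t) \<le> p * \<gamma> * q * norm (z t\<^sub>0)"
    if est: "\<And>x. ivp_solution T A t\<^sub>0 (x t\<^sub>0) x \<Longrightarrow> norm (x t) \<le> \<gamma> * norm (x t\<^sub>0)"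
      and z: "ivp_solution T B t\<^sub>0 z\<^sub>0 z" and "\<gamma> > 0" "t\<^sub>0 \<in> T" "t \<in> T" for z t t\<^sub>0 z\<^sub>0 \<gamma>
  proof -
    obtain x where x: "ivp_solution T A t\<^sub>0 (x t\<^sub>0) x"
      and *: "norm (z t) \<le> p * norm (x t)" "norm (x t\<^sub>0) \<le> q * norm (z t\<^sub>0)"
      using corr[OF z] \<open>t\<^sub>0 \<in> T\<close> \<open>t \<in> T\<close> by blast
    note *(1)
    also have "p * norm (x t) \<le> p * (\<gamma> * norm (x t\<^sub>0))"
      using est[OF x] assms(1) by simp
    also have "\<dots> \<le> p * (\<gamma> * (q * norm (z t\<^sub>0)))"
      using * \<open>\<gamma> > 0\<close> assms(1) by simp
    finally show ?thesis by (simp add: mult.assoc)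
  qed
  have "uniformly_stable T B"
  proof -
    obtain \<gamma> where \<gamma>: "\<gamma> > 0" "\<And>t\<^sub>0 x\<^sub>0 x t. \<lbrakk>t\<^sub>0 \<in> T; ivp_solution T A t\<^sub>0 x\<^sub>0 x; t \<in> T; t \<ge> t\<^sub>0\<rbrakk> \<Longrightarrow>
        norm (x t) \<le> \<gamma> * norm (x t\<^sub>0)"
      using stable unfolding uniformly_asymptotically_stable_def uniformly_stable_def by blast
    show ?thesis
      unfolding uniformly_stable_def
      using assms(1,2) \<gamma> by (intro exI[of _ "p * \<gamma> * q"] conjI ballI allI impI estimate) auto
  qed
  moreover have "\<exists>\<tau>>0. \<forall>t\<^sub>0\<in>T. \<forall>z\<^sub>0 z. ivp_solution T B t\<^sub>0 z\<^sub>0 z \<longrightarrow>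
      (\<forall>t\<in>T. t \<ge> t\<^sub>0 + \<tau> \<longrightarrow> norm (z t) \<le> \<delta> * norm (z t\<^sub>0))" if "\<delta> > 0" for \<delta>
  proof -
    \<comment> \<open>The comparison loses a factor \<open>p * q\<close>; demanding decay to
      \<open>\<delta> / (p * q)\<close> from the system of \<open>A\<close> makes up for it, with
      the same \<open>\<tau>\<close>.\<close>
    define \<epsilon> where "\<epsilon> = \<delta> / (p * q)"
    have \<epsilon>: "\<epsilon> > 0" "p * \<epsilon> * q = \<delta>"
      using assms(1,2) that by (auto simp: \<epsilon>_def)
    have "\<exists>\<tau>>0. \<forall>t\<^sub>0\<in>T. \<forall>x\<^sub>0 x. ivp_solution T A t\<^sub>0 x\<^sub>0 x \<longrightarrow>
        (\<forall>t\<in>T. t \<ge> t\<^sub>0 + \<tau> \<longrightarrow> norm (x t) \<le> \<epsilon> * norm (x t\<^sub>0))"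
      using stable \<epsilon>(1) unfolding uniformly_asymptotically_stable_def by simp
    then obtain \<tau> where \<tau>: "\<tau> > 0" "\<And>t\<^sub>0 x\<^sub>0 x t. \<lbrakk>t\<^sub>0 \<in> T; ivp_solution T A t\<^sub>0 x\<^sub>0 x; t \<in> T; t \<ge> t\<^sub>0 + \<tau>\<rbrakk> \<Longrightarrow>
        norm (x t) \<le> \<epsilon> * norm (x t\<^sub>0)"
      by blast
    show ?thesis
      unfolding \<epsilon>(2)[symmetric]
      using \<tau> \<epsilon>(1) by (intro exI[of _ \<tau>] conjI ballI allI impI estimate) auto
  qed
  ultimately show ?thesis
    unfolding uniformly_asymptotically_stable_def by blast
qed

section \<open>Correspondence of solutions and equivalence of the stability notions\<close>

theorem corollary2p13:
  fixes T :: "real set" and A L :: "real \<Rightarrow> real^'n^'n"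
  assumes "time_scale T"
    and "regressive T A"
    and "lyapunov_transformation T L"
  shows "uniformly_asymptotically_stable T A \<longleftrightarrow>
    uniformly_asymptotically_stable T
      (\<lambda>t. matrix_inv (L (forward_jump T t)) ** A t ** L t
         - matrix_inv (L (forward_jump T t)) ** delta_deriv T L t)"
proof -
  define B where "B = (\<lambda>t. matrix_inv (L (forward_jump T t)) ** A t ** L t
         - matrix_inv (L (forward_jump T t)) ** delta_deriv T L t)"
  obtain \<eta> \<rho> where \<eta>: "\<eta> > 0" and \<rho>: "\<rho> > 0"
    and L_bounds: "\<And>t. t \<in> T \<Longrightarrow> onorm ((*v) (L t)) \<le> \<rho>" "\<And>t. t \<in> T \<Longrightarrow> det (L t) \<ge> \<eta>"
    and inv: "\<And>t. t \<in> T \<Longrightarrow> invertible (L t)" and C1: "C1_rd T L"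
    using assms(3) unfolding lyapunov_transformation_def by blast
  \<comment> \<open>\<open>delta_deriv\<close> is a choice operator; on \<open>kappa T\<close> a
    derivative exists, so the chosen value is one.\<close>
  have deriv_L: "has_delta_derivative T L (delta_deriv T L t) t" if "t \<in> kappa T" for t
    using C1 that unfolding delta_deriv_def
    by (intro someI_ex[of "\<lambda>D. has_delta_derivative T L D t"]) (simp add: C1_rd_def)
  obtain c where c: "c > 0"
    and lb: "\<forall>(M :: real^'n^'n) v. onorm ((*v) M) \<le> \<rho> \<and> det M \<ge> \<eta> \<longrightarrow>
      c * norm v \<le> norm (M *v v)"
    using matrix_uniform_lower_bound[OF \<eta>] by blast
  have lower: "c * norm v \<le> norm (L t *v v)" if "t \<in> T" for t v
    using lb L_bounds that by blast
  have upper: "norm (L t *v v) \<le> \<rho> * norm v" if "t \<in> T" for t v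
    by (rule order_trans[OF onorm[OF matrix_vector_mul_bounded_linear]
        mult_right_mono[OF L_bounds(1)[OF that] norm_ge_zero]])
  \<comment> \<open>The product rule with \<open>w = A t *v (L t *v z t)\<close> and
    \<open>D = delta_deriv T L t\<close> produces exactly the coefficient
    \<open>B t\<close>.\<close>
  have step: "has_delta_derivative T (\<lambda>s. L s *v z s) (A t *v (L t *v z t)) t \<longleftrightarrow>
      has_delta_derivative T z (B t *v z t) t"
    if "t \<in> kappa T" "continuous (at t within T) z" for t z
  proof -
    have "forward_jump T t \<in> T"
      using forward_jump_in_time_scale assms(1) kappa_subset that(1) by blast
    moreover have "matrix_inv (L (forward_jump T t)) *v (A t *v (L t *v z t) - delta_deriv T L t *v z t)
        = B t *v z t"
      by (simp add: B_def matrix_vector_mult_diff_distrib matrix_vector_mult_diff_rdistrib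
          matrix_vector_mul_assoc matrix_mul_assoc)
    ultimately show ?thesis
      using has_delta_derivative_matrix_mult_iff[OF deriv_L that(2) inv] that(1) by simp
  qed
  \<comment> \<open>\<open>step\<close> presupposes continuity of \<open>z\<close>. Either side
    supplies it: directly from the equation for \<open>z\<close>, or from that for
    \<open>L z\<close> through the lower bound on \<open>L\<close>. The initial conditions are
    trivial on both sides.\<close>
  have solution_iff: "ivp_solution T A t\<^sub>0 (L t\<^sub>0 *v z t\<^sub>0) (\<lambda>s. L s *v z s) \<longleftrightarrow>
      ivp_solution T B t\<^sub>0 (z t\<^sub>0) z" for z t\<^sub>0
  proof -
    have "continuous (at t within T) z"
      if "t \<in> kappa T" "has_delta_derivative T (\<lambda>s. L s *v z s) (A t *v (L t *v z t)) t" for t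
    proof (rule continuous_of_continuous_mult_matrix[OF c lower])
      show "continuous (at t within T) L" "continuous (at t within T) (\<lambda>s. L s *v z s)"
        using has_delta_derivative_continuous deriv_L that kappa_subset by blast+
    qed
    moreover have "continuous (at t within T) z"
      if "t \<in> kappa T" "has_delta_derivative T z (B t *v z t) t" for t
      using has_delta_derivative_continuous that kappa_subset by blast
    ultimately show ?thesis
      unfolding ivp_solution_def using step by blast
  qed
  have comparable: "norm v \<le> 1 / c * norm (L t *v v)" if "t \<in> T" for t v
    using lower[OF that, of v] c by (simp add: field_simps)
  show ?thesis
    unfolding B_def[symmetric]
  proof
    assume "uniformly_asymptotically_stable T A"
    then show "uniformly_asymptotically_stable T B"
    \<comment> \<open>Given \<open>z\<close>, take \<open>x = L z\<close>: then \<open>1 / c\<close>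
      bounds \<open>z\<close> by \<open>x\<close> and \<rho> bounds \<open>x\<close> by
      \<open>z\<close>. The converse swaps the two constants.\<close>
    proof (rule uniformly_asymptotically_stable_transfer[of "1 / c" \<rho>, rotated 3])
      fix t\<^sub>0 z\<^sub>0 z assume "ivp_solution T B t\<^sub>0 z\<^sub>0 z"
      then have "ivp_solution T B t\<^sub>0 (z t\<^sub>0) z"
        by (simp add: ivp_solution_def)
      then show "\<exists>x. ivp_solution T A t\<^sub>0 (x t\<^sub>0) x \<and>
          (\<forall>t\<in>T. norm (z t) \<le> 1 / c * norm (x t) \<and> norm (x t) \<le> \<rho> * norm (z t))"
        using solution_iff comparable upper by (intro exI[of _ "\<lambda>s. L s *v z s"]) blast
    qed (use c \<rho> in auto)
  next
    assume "uniformly_asymptotically_stable T B"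
    then show "uniformly_asymptotically_stable T A"
    proof (rule uniformly_asymptotically_stable_transfer[of \<rho> "1 / c", rotated 3])
      fix t\<^sub>0 x\<^sub>0 x assume x: "ivp_solution T A t\<^sub>0 x\<^sub>0 x"
      \<comment> \<open>Invertibility of \<open>L\<close> is known on \<open>T\<close> only, so
        \<open>L z = x\<close> holds just there; the delta derivative sees only values on
        \<open>T\<close>, which allows \<open>x\<close> to be replaced by
        \<open>L z\<close>.\<close>
      define z where "z = (\<lambda>s. matrix_inv (L s) *v x s)"
      have Lz: "L s *v z s = x s" if "s \<in> T" for s
        using inv[OF that] by (simp add: z_def matrix_vector_mul_assoc matrix_inv_right)
      have "has_delta_derivative T (\<lambda>s. L s *v z s) (A t *v (L t *v z t)) t" if "t \<in> kappa T" for t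
      proof -
        have "t \<in> T" using that kappa_subset by blast
        then have "has_delta_derivative T (\<lambda>s. L s *v z s) (A t *v x t) t"
          using x that has_delta_derivative_cong[of T "\<lambda>s. L s *v z s" x] Lz
            forward_jump_in_time_scale[OF assms(1)]
          by (simp add: ivp_solution_def)
        then show ?thesis
          using Lz[OF \<open>t \<in> T\<close>] by simp
      qed
      \<comment> \<open>The initial value is whatever \<open>z\<close> takes at
        \<open>t\<^sub>0\<close>; as \<open>t\<^sub>0\<close> may lie outside \<open>T\<close> here,
        it is not expressed through \<open>x\<^sub>0\<close>.\<close>
      then have "ivp_solution T B t\<^sub>0 (z t\<^sub>0) z"
        unfolding solution_iff[symmetric] by (simp add: ivp_solution_def)
      moreover have "norm (x t) \<le> \<rho> * norm (z t) \<and> norm (z t) \<le> 1 / c * norm (x t)" if "t \<in> T" for t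
        using upper[OF that, of "z t"] comparable[OF that, of "z t"] Lz[OF that] by simp
      ultimately show "\<exists>z. ivp_solution T B t\<^sub>0 (z t\<^sub>0) z \<and>
          (\<forall>t\<in>T. norm (x t) \<le> \<rho> * norm (z t) \<and> norm (z t) \<le> 1 / c * norm (x t))"
        by blast
    qed (use c \<rho> in auto)
  qed
qed

end
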